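(* If $G$ is a line perfect graph, then $\chi'_{trans}(G)\leq 4$.
   Context: Graphs are finite and simple. A graph is line perfect if its line graph is a perfect graph. A proper $t$-coloring of $G$ is a map $E(G)\to\{1,\dots,t\}$ with adjacent edges receiving distinct colors; $\chi'(G)$ is the chromatic index; $M(f,j)$ is the set of edges of color $j$. Two $t$-colorings differ by at most $n$ color classes if the number of colors $j$ with $M(f,j)\neq M(g,j)$ is at most $n$; proper $t$-colorings $f,g$ are $n$-equivalent if there is a sequence $f_0=f,\dots,f_k=g$ ($k\geq 1$) of proper $t$-colorings with consecutive ones differing by at most $n$ color classes. $\chi'_{trans}(G)$ is the minimum integer $n\geq 2$ such that any two proper $\chi'(G)$-colorings of $G$ are $n$-equivalent. *)

theory Defs
  imports Main "HOL-Library.FuncSet"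
begin

type_synonym 'a graph = "'a set \<times> 'a set set"

abbreviation verts :: "'a graph \<Rightarrow> 'a set" where "verts G \<equiv> fst G"
abbreviation edges :: "'a graph \<Rightarrow> 'a set set" where "edges G \<equiv> snd G"

definition simple_graph :: "'a graph \<Rightarrow> bool" where
  "simple_graph G \<longleftrightarrow> finite (verts G) \<and> (\<forall>e\<in>edges G. e \<subseteq> verts G \<and> card e = 2)"

definition induced_subgraph :: "'a graph \<Rightarrow> 'a set \<Rightarrow> 'a graph" where
  "induced_subgraph G U = (U, {e \<in> edges G. e \<subseteq> U})"

definition proper_vertex_coloring :: "'a graph \<Rightarrow> nat \<Rightarrow> ('a \<Rightarrow> nat) \<Rightarrow> bool" where
  "proper_vertex_coloring G k c \<longleftrightarrow>
     c \<in> verts G \<rightarrow>\<^sub>E {1..k} \<and> (\<forall>u v. {u, v} \<in> edges G \<longrightarrow> c u \<noteq> c v)"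

definition chromatic_number :: "'a graph \<Rightarrow> nat" where
  "chromatic_number G = (LEAST k. \<exists>c. proper_vertex_coloring G k c)"

definition clique :: "'a graph \<Rightarrow> 'a set \<Rightarrow> bool" where
  "clique G K \<longleftrightarrow> K \<subseteq> verts G \<and> (\<forall>u\<in>K. \<forall>v\<in>K. u \<noteq> v \<longrightarrow> {u, v} \<in> edges G)"

definition clique_number :: "'a graph \<Rightarrow> nat" where
  "clique_number G = Max {card K | K. clique G K}"

definition perfect_graph :: "'a graph \<Rightarrow> bool" where
  "perfect_graph G \<longleftrightarrow>
     (\<forall>U \<subseteq> verts G. chromatic_number (induced_subgraph G U) = clique_number (induced_subgraph G U))"

definition adjacent_edges :: "'a set \<Rightarrow> 'a set \<Rightarrow> bool" where
  "adjacent_edges e e' \<longleftrightarrow> e \<noteq> e' \<and> e \<inter> e' \<noteq> {}"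

definition line_graph :: "'a graph \<Rightarrow> 'a set graph" where
  "line_graph G = (edges G, {{e, e'} | e e'. e \<in> edges G \<and> e' \<in> edges G \<and> adjacent_edges e e'})"

definition line_perfect :: "'a graph \<Rightarrow> bool" where
  "line_perfect G \<longleftrightarrow> perfect_graph (line_graph G)"

definition proper_coloring :: "'a graph \<Rightarrow> nat \<Rightarrow> ('a set \<Rightarrow> nat) \<Rightarrow> bool" where
  "proper_coloring G t f \<longleftrightarrow>
     f \<in> edges G \<rightarrow>\<^sub>E {1..t} \<and>
     (\<forall>e\<in>edges G. \<forall>e'\<in>edges G. adjacent_edges e e' \<longrightarrow> f e \<noteq> f e')"

definition chromatic_index :: "'a graph \<Rightarrow> nat" where
  "chromatic_index G = (LEAST t. \<exists>f. proper_coloring G t f)"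

definition color_class :: "'a graph \<Rightarrow> ('a set \<Rightarrow> nat) \<Rightarrow> nat \<Rightarrow> 'a set set" where
  "color_class G f j = {e \<in> edges G. f e = j}"

definition differ_by_at_most ::
  "'a graph \<Rightarrow> nat \<Rightarrow> nat \<Rightarrow> ('a set \<Rightarrow> nat) \<Rightarrow> ('a set \<Rightarrow> nat) \<Rightarrow> bool" where
  "differ_by_at_most G t n f g \<longleftrightarrow>
     card {j \<in> {1..t}. color_class G f j \<noteq> color_class G g j} \<le> n"

definition n_equivalent ::
  "'a graph \<Rightarrow> nat \<Rightarrow> nat \<Rightarrow> ('a set \<Rightarrow> nat) \<Rightarrow> ('a set \<Rightarrow> nat) \<Rightarrow> bool" where
  "n_equivalent G t n f g \<longleftrightarrow>
     (\<exists>k (h :: nat \<Rightarrow> 'a set \<Rightarrow> nat). k \<ge> 1 \<and> h 0 = f \<and> h k = g \<and>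
        (\<forall>i\<le>k. proper_coloring G t (h i)) \<and>
        (\<forall>i<k. differ_by_at_most G t n (h i) (h (Suc i))))"

text \<open>The minimum exists for every finite simple graph: any two proper \<open>t\<close>-colorings are
  \<open>t\<close>-equivalent, so \<open>n = max 2 t\<close> with \<open>t\<close> the chromatic index satisfies the condition.\<close>

definition chi_trans :: "'a graph \<Rightarrow> nat" where
  "chi_trans G = (LEAST n. n \<ge> 2 \<and>
     (\<forall>f g. proper_coloring G (chromatic_index G) f \<longrightarrow> proper_coloring G (chromatic_index G) g \<longrightarrow>
        n_equivalent G (chromatic_index G) n f g))"

end

theory Submission imports Defs
begin

text \<open>
  Perfection of the line graph is used only through one consequence: every set of edges of maximum
  degree at most 3 is 3-edge-colorable, because a clique of a line graph is a star or a triangle.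

  By induction on the number of colors it suffices to move \<open>f\<close> to a coloring whose class \<open>t\<close>
  contains \<open>M = M(g,t)\<close>: then \<open>g\<close> can be recolored edge by edge to have that same class, which is
  removed. Fix a set \<open>S\<close> of four colors containing \<open>t\<close>, let \<open>H\<close> be the edges with color in \<open>S\<close>, and
  let \<open>F\<close> be a matching in \<open>H\<close> such that \<open>H - F\<close> has at most two vertices of degree 4. Such an \<open>F\<close>
  need not be a color class, but it can be driven towards \<open>M\<close> by exchanging edges, since an exchange
  creates at most as many new vertices of excessive degree as are allowed. If an edge to be exchanged
  has a color \<open>c\<close> outside \<open>S\<close>, a matching \<open>N\<close> of \<open>H - F\<close> is found such that \<open>H - N\<close> has maximum
  degree 3; recoloring \<open>H\<close> so that \<open>N\<close> becomes a class frees one color of \<open>S\<close>, which is replaced by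
  \<open>c\<close>. Once \<open>H - F\<close> has maximum degree 3, \<open>F\<close> itself becomes the class \<open>t\<close>.
\<close>

section \<open>Edge sets and colorings\<close>

definition edges_at :: "'a set set \<Rightarrow> 'a \<Rightarrow> 'a set set" where
  "edges_at K v = {e \<in> K. v \<in> e}"

text \<open>The color set is arbitrary and values off \<open>K\<close> are free, so palettes can
  lose single colors and colorings of parts can be glued by case distinction.\<close>

definition proper_on :: "'a set set \<Rightarrow> nat set \<Rightarrow> ('a set \<Rightarrow> nat) \<Rightarrow> bool" where
  "proper_on K C f \<longleftrightarrow> f ` K \<subseteq> C \<and> (\<forall>v. inj_on f (edges_at K v))"

text \<open>Only classes with a color in \<open>S\<close> can change, which later gives the bound of
  four differing classes.\<close>

definition recolor_step ::
  "'a set set \<Rightarrow> nat set \<Rightarrow> ('a set \<Rightarrow> nat) \<Rightarrow> ('a set \<Rightarrow> nat) \<Rightarrow> bool" where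
  "recolor_step E T f g \<longleftrightarrow> proper_on E T f \<and> proper_on E T g \<and>
     (\<exists>S. finite S \<and> card S \<le> 4 \<and> (\<forall>e\<in>E. f e = g e \<or> f e \<in> S \<and> g e \<in> S))"

text \<open>These vertices are what keeps \<open>three_colorable\<close> from applying to
  \<open>K\<close>.\<close>

definition excess :: "'a set set \<Rightarrow> 'a set" where
  "excess K = {v. card (edges_at K v) \<ge> 4}"

lemma edges_at_simps:
  "edges_at (A \<union> B) v = edges_at A v \<union> edges_at B v"
  "edges_at (A - B) v = edges_at A v - edges_at B v"
  "edges_at {} v = {}"
  "edges_at (insert e A) v = (if v \<in> e then insert e (edges_at A v) else edges_at A v)"
  by (auto simp: edges_at_def)

lemma edges_at_mono: "A \<subseteq> B \<Longrightarrow> edges_at A v \<subseteq> edges_at B v"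
  by (auto simp: edges_at_def)

lemma finite_edges_at [simp]: "finite K \<Longrightarrow> finite (edges_at K v)"
  by (simp add: edges_at_def)

lemma card_edges_at_mono:
  "finite B \<Longrightarrow> A \<subseteq> B \<Longrightarrow> card (edges_at A v) \<le> card (edges_at B v)"
  by (simp add: card_mono edges_at_mono)

lemma proper_on_subset: "proper_on K C f \<Longrightarrow> K' \<subseteq> K \<Longrightarrow> f ` K' \<subseteq> C' \<Longrightarrow> proper_on K' C' f"
  unfolding proper_on_def by (meson edges_at_mono inj_on_subset)

lemma proper_on_card_colors:
  assumes "proper_on K T f" "finite S"
  shows "card (edges_at {e \<in> K. f e \<in> S} v) \<le> card S"
proof (rule card_inj_on_le[of f])
  show "inj_on f (edges_at {e \<in> K. f e \<in> S} v)"
    using assms(1) unfolding proper_on_def inj_on_def edges_at_def by blast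
qed (use assms(2) in \<open>auto simp: edges_at_def\<close>)

text \<open>As \<open>H\<close> contains every edge with a color in \<open>S\<close>, the other
  edges avoid \<open>S\<close> and cannot clash with a new coloring of \<open>H\<close> from
  \<open>S\<close>.\<close>

lemma proper_on_override:
  assumes f: "proper_on E T f" and S: "S \<subseteq> T" and H: "H = {e \<in> E. f e \<in> S}"
    and \<psi>: "proper_on H S \<psi>"
  shows "proper_on E T (\<lambda>e. if e \<in> H then \<psi> e else f e)"
  unfolding proper_on_def
proof (intro conjI allI inj_onI)
  show "(\<lambda>e. if e \<in> H then \<psi> e else f e) ` E \<subseteq> T"
    using f \<psi> S unfolding proper_on_def by auto
next
  fix v x y
  assume x: "x \<in> edges_at E v" and y: "y \<in> edges_at E v"
    and eq: "(if x \<in> H then \<psi> x else f x) = (if y \<in> H then \<psi> y else f y)"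
  have \<psi>S: "\<psi> e \<in> S" if "e \<in> H" for e using \<psi> that unfolding proper_on_def by auto
  have fS: "f e \<notin> S" if "e \<notin> H" "e \<in> E" for e using that H by auto
  have xE: "x \<in> E" "y \<in> E" "v \<in> x" "v \<in> y" using x y by (auto simp: edges_at_def)
  consider "x \<in> H" "y \<in> H" | "x \<notin> H" "y \<notin> H" | "x \<in> H" "y \<notin> H" | "x \<notin> H" "y \<in> H" by blast
  then show "x = y"
  proof cases
    case 1
    then have "x \<in> edges_at H v" "y \<in> edges_at H v" using xE by (auto simp: edges_at_def)
    then show ?thesis using \<psi> eq 1 unfolding proper_on_def inj_on_def by auto
  next
    case 2
    then show ?thesis using f eq x y unfolding proper_on_def inj_on_def by auto
  next
    case 3 then show ?thesis using eq \<psi>S[of x] fS[of y] xE by auto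
  next
    case 4 then show ?thesis using eq \<psi>S[of y] fS[of x] xE by auto
  qed
qed

lemma recolor_step_override:
  assumes "proper_on E T f" and "S \<subseteq> T" and "H = {e \<in> E. f e \<in> S}"
    and "proper_on H S \<psi>" and "finite S" "card S \<le> 4"
  shows "recolor_step E T f (\<lambda>e. if e \<in> H then \<psi> e else f e)"
  unfolding recolor_step_def
proof (intro conjI exI[of _ S] ballI)
  show "proper_on E T (\<lambda>e. if e \<in> H then \<psi> e else f e)"
    using proper_on_override assms by blast
  fix e assume "e \<in> E"
  then show "f e = (if e \<in> H then \<psi> e else f e) \<or> f e \<in> S \<and> (if e \<in> H then \<psi> e else f e) \<in> S"
    using assms(3,4) by (auto simp: proper_on_def)
qed (use assms in auto)

text \<open>This turns a chosen matching into a color class: the fresh color \<open>d\<close> cannot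
  clash with \<open>C\<close>.\<close>

lemma proper_on_Un:
  assumes A: "proper_on A C f" and B: "\<And>v. card (edges_at B v) \<le> 1" "finite B" and d: "d \<notin> C"
  shows "proper_on (A \<union> B) (insert d C) (\<lambda>e. if e \<in> B then d else f e)"
  unfolding proper_on_def
proof (intro conjI allI inj_onI)
  show "(\<lambda>e. if e \<in> B then d else f e) ` (A \<union> B) \<subseteq> insert d C"
    using A unfolding proper_on_def by auto
next
  fix v x y
  assume x: "x \<in> edges_at (A \<union> B) v" and y: "y \<in> edges_at (A \<union> B) v"
    and eq: "(if x \<in> B then d else f x) = (if y \<in> B then d else f y)"
  have fC: "f e \<in> C" if "e \<in> A" for e using A that unfolding proper_on_def by auto
  consider "x \<in> B" "y \<in> B" | "x \<notin> B" "y \<notin> B"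
    using eq d fC[of x] fC[of y] x y by (auto simp: edges_at_def split: if_splits)
  then show "x = y"
  proof cases
    case 1
    then have "x \<in> edges_at B v" "y \<in> edges_at B v" using x y by (auto simp: edges_at_def)
    then show ?thesis using B(1)[of v] card_le_Suc0_iff_eq[OF finite_edges_at[OF B(2)], of v] by simp
  next
    case 2
    then have "x \<in> edges_at A v" "y \<in> edges_at A v" using x y by (auto simp: edges_at_def)
    then show ?thesis using A eq 2 unfolding proper_on_def inj_on_def by auto
  qed
qed

lemma color_class_matching:
  assumes "proper_on K C f"
  shows "card (edges_at {e \<in> K. f e = d} v) \<le> 1"
  using proper_on_card_colors[OF assms, of "{d}" v] by simp

section \<open>Subcubic edge sets\<close>

text \<open>Quantifying over all subsets \<open>K\<close> lets the property pass to subsets of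
  \<open>E\<close>, as needed once a class has been deleted.\<close>

locale subcubic_colorable =
  fixes E :: "'a set set"
  assumes finite_E: "finite E"
    and card_edge: "\<And>e. e \<in> E \<Longrightarrow> card e = 2"
    and three_colorable:
      "\<And>K. K \<subseteq> E \<Longrightarrow> (\<And>v. card (edges_at K v) \<le> 3) \<Longrightarrow> \<exists>f. proper_on K {1..3} f"
begin

lemma colorable:
  assumes "K \<subseteq> E" "\<And>v. card (edges_at K v) \<le> 3" "card C = 3"
  shows "\<exists>f. proper_on K C f"
proof -
  obtain f where f: "proper_on K {1..3} f" using three_colorable assms by blast
  have "finite C" using assms(3) by (simp add: card_ge_0_finite)
  then obtain h :: "nat \<Rightarrow> nat" where h: "bij_betw h {1..3} C"
    using assms(3) finite_same_card_bij[of "{1..3::nat}" C] by auto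
  have "proper_on K C (h \<circ> f)"
    unfolding proper_on_def
  proof (intro conjI allI)
    show "(h \<circ> f) ` K \<subseteq> C" using f h unfolding proper_on_def bij_betw_def by auto
    fix v
    have "f ` edges_at K v \<subseteq> {1..3}" using f unfolding proper_on_def edges_at_def by auto
    then show "inj_on (h \<circ> f) (edges_at K v)"
      using f h unfolding proper_on_def bij_betw_def by (meson comp_inj_on inj_on_subset)
  qed
  then show ?thesis by blast
qed

lemma finite_excess: "K \<subseteq> E \<Longrightarrow> finite (excess K)"
proof -
  assume K: "K \<subseteq> E"
  have "excess K \<subseteq> \<Union>E"
  proof
    fix v assume "v \<in> excess K"
    then have "edges_at K v \<noteq> {}" by (auto simp: excess_def)
    then show "v \<in> \<Union>E" using K by (auto simp: edges_at_def)
  qed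
  moreover have "finite (\<Union>E)" using finite_E card_edge by (metis card.infinite finite_Union zero_neq_numeral)
  ultimately show ?thesis by (rule finite_subset)
qed

text \<open>Nothing is required at vertices of \<open>D\<close>, so only the other end of
  \<open>e\<close> matters. If it lies outside \<open>D\<close>, at most two edges of
  \<open>L\<close> meet it, and one of the three colors is free there.\<close>

lemma extend_coloring:
  fixes \<psi> :: "'a set \<Rightarrow> nat"
  assumes K: "K \<subseteq> E" and deg: "\<And>v. v \<notin> D \<Longrightarrow> card (edges_at K v) \<le> 3"
    and L: "insert e L \<subseteq> K" "e \<notin> L"
    and D: "e \<inter> D \<noteq> {}"
    and \<psi>: "\<psi> ` L \<subseteq> C" "\<And>v. v \<notin> D \<Longrightarrow> inj_on \<psi> (edges_at L v)" and C: "card C = 3"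
  shows "\<exists>c\<in>C. \<forall>v. v \<notin> D \<longrightarrow> inj_on (\<psi>(e := c)) (edges_at (insert e L) v)"
proof -
  have e2: "card e = 2" using card_edge K L by auto
  have finL: "finite L" using L K finite_E by (meson finite_subset insert_subset)
  obtain x z where xz: "e = {x, z}" "x \<in> D"
  proof -
    obtain x where "x \<in> e" "x \<in> D" using D by auto
    moreover obtain a b where "e = {a, b}" using e2 by (auto simp: card_2_iff)
    ultimately show ?thesis using that by blast
  qed
  have "\<exists>c\<in>C. z \<notin> D \<longrightarrow> c \<notin> \<psi> ` edges_at L z"
  proof (cases "z \<in> D")
    case True
    have "C \<noteq> {}" using C by auto
    then show ?thesis using True by blast
  next
    case False
    have "card (edges_at (insert e L) z) \<le> card (edges_at K z)"
      using L K finite_E by (meson card_edges_at_mono finite_subset)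
    also have "\<dots> \<le> 3" using deg False by blast
    finally have "Suc (card (edges_at L z)) \<le> 3"
      using L(2) finL xz(1) by (simp add: edges_at_simps) (simp add: edges_at_def)
    then have "card (\<psi> ` edges_at L z) < card C"
      using C card_image_le[of "edges_at L z" \<psi>] finL by auto
    then have "\<not> C \<subseteq> \<psi> ` edges_at L z"
      using finL by (meson card_mono finite_edges_at finite_imageI not_le)
    then show ?thesis by blast
  qed
  then obtain c where c: "c \<in> C" "z \<notin> D \<longrightarrow> c \<notin> \<psi> ` edges_at L z" by blast
  have "inj_on (\<psi>(e := c)) (edges_at (insert e L) v)" if v: "v \<notin> D" for v
  proof -
    have 1: "inj_on (\<psi>(e := c)) (edges_at L v)"
      using \<psi>(2)[OF v] L(2) by (auto simp: inj_on_def edges_at_def)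
    show ?thesis
    proof (cases "v \<in> e")
      case True
      then have "v = z" using v xz by auto
      then have "c \<notin> \<psi> ` edges_at L v" using c v by blast
      then have "(\<psi>(e := c)) e \<notin> (\<psi>(e := c)) ` (edges_at L v - {e})"
        by auto
      then show ?thesis using 1 True unfolding edges_at_simps by simp
    next
      case False
      then show ?thesis using 1 by (simp add: edges_at_simps)
    qed
  qed
  then show ?thesis using c by blast
qed

lemma coloring_proper_off_excess:
  assumes K: "K \<subseteq> E" and deg: "\<And>v. card (edges_at K v) \<le> 4" and D: "card (excess K) \<le> 2"
    and C: "card (C :: nat set) = 3"
  shows "\<exists>R \<psi>. R \<subseteq> K \<and> finite R \<and> card R \<le> 2 \<and> \<psi> ` K \<subseteq> C \<and> proper_on (K - R) C \<psi> \<and>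
           (\<forall>v. v \<notin> excess K \<longrightarrow> inj_on \<psi> (edges_at K v)) \<and>
           (\<forall>v. v \<in> excess K \<longrightarrow> card (edges_at (K - R) v) = 3)"
proof -
  define D where "D = excess K"
  have finK: "finite K" using K finite_E finite_subset by blast
  have degD: "card (edges_at K v) = 4" if "v \<in> D" for v
    using that deg[of v] unfolding D_def excess_def by auto
  have degnD: "card (edges_at K v) \<le> 3" if "v \<notin> D" for v
    using that unfolding D_def excess_def by auto
  have finD: "finite D" using finite_excess K D_def by blast
  have minus1: "card (edges_at (K - R) v) = 3" if "v \<in> D" "edges_at R v = {e}" "e \<in> K" for R v e
  proof -
    have "e \<in> edges_at K v" using that by (auto simp: edges_at_def)
    then show ?thesis using degD[OF that(1)] that(2) finK by (simp add: edges_at_simps)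
  qed
  have sub: "card (edges_at (K - R) v) \<le> 3"
    if "\<And>v. v \<in> D \<Longrightarrow> card (edges_at (K - R) v) = 3" for R v
  proof (cases "v \<in> D")
    case True then show ?thesis using that by auto
  next
    case False
    then show ?thesis using degnD[OF False] card_edges_at_mono[OF finK, of "K - R" v] by auto
  qed
  have edge_ex: "\<exists>e\<in>K. v \<in> e" if "v \<in> D" for v
  proof -
    have "edges_at K v \<noteq> {}" using degD[OF that] by auto
    then show ?thesis by (auto simp: edges_at_def)
  qed
  have main: "\<exists>R. R \<subseteq> K \<and> finite R \<and> card R \<le> 2 \<and> (\<forall>e\<in>R. e \<inter> D \<noteq> {}) \<and>
           (\<forall>v\<in>D. \<exists>e\<in>K. edges_at R v = {e})"
  \<comment> \<open>One edge through all excess vertices serves alone. Such an edge is lacking only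
    if \<open>D\<close> is empty or consists of two vertices not joined in \<open>K\<close>; then an
    edge chosen at either one misses the other.\<close>
  proof (cases "\<exists>e\<in>K. D \<subseteq> e \<and> D \<noteq> {}")
    case True
    then obtain e where e: "e \<in> K" "D \<subseteq> e" "D \<noteq> {}" by auto
    then show ?thesis
      by (intro exI[of _ "{e}"]) (auto simp: edges_at_def)
  next
    case no: False
    show ?thesis
    proof (cases "D = {}")
      case True then show ?thesis by (intro exI[of _ "{}"]) auto
    next
      case False
      have "card D \<noteq> 1"
      proof
        assume "card D = 1"
        then obtain x where x: "D = {x}" by (auto simp: card_1_singleton_iff)
        then show False using edge_ex[of x] no by auto
      qed
      then have "card D = 2" using D False finD unfolding D_def
        by (metis One_nat_def Suc_1 card_0_eq le_SucE le_zero_eq)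
      then obtain x y where xy: "D = {x, y}" "x \<noteq> y" by (auto simp: card_2_iff)
      obtain e where e: "e \<in> K" "x \<in> e" using edge_ex xy by auto
      obtain e' where e': "e' \<in> K" "y \<in> e'" using edge_ex xy by auto
      have "y \<notin> e" "x \<notin> e'" using no e e' xy by auto
      then have "edges_at {e, e'} x = {e}" "edges_at {e, e'} y = {e'}"
        using e e' by (auto simp: edges_at_simps)
      moreover have "card {e, e'} \<le> 2" by (simp add: card_insert_if)
      ultimately show ?thesis using e e' xy by (intro exI[of _ "{e, e'}"]) blast
    qed
  qed
  then obtain R where R: "R \<subseteq> K" "finite R" "card R \<le> 2" "\<forall>e\<in>R. e \<inter> D \<noteq> {}"
    "\<forall>v\<in>D. \<exists>e\<in>K. edges_at R v = {e}" by blast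
  have RD: "card (edges_at (K - R) v) = 3" if "v \<in> D" for v
    using R(5) that minus1 by blast
  obtain \<psi>0 where \<psi>0: "proper_on (K - R) C \<psi>0"
    using colorable[of "K - R" C] sub[OF RD] K C by blast
  \<comment> \<open>An edge of \<open>R\<close> has at most one end outside \<open>D\<close>, so it can be colored greedily.\<close>
  have "\<exists>\<psi>. \<psi> ` ((K - R) \<union> X) \<subseteq> C \<and> (\<forall>e\<in>K - R. \<psi> e = \<psi>0 e) \<and>
          (\<forall>v. v \<notin> D \<longrightarrow> inj_on \<psi> (edges_at ((K - R) \<union> X) v))" if "X \<subseteq> R" for X
    using finite_subset[OF that R(2)] that
  proof (induction X rule: finite_induct)
    case empty
    then show ?case using \<psi>0 unfolding proper_on_def by (intro exI[of _ \<psi>0]) auto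
  next
    case (insert e X)
    then obtain \<psi> where \<psi>: "\<psi> ` ((K - R) \<union> X) \<subseteq> C" "\<forall>e\<in>K - R. \<psi> e = \<psi>0 e"
       "\<forall>v. v \<notin> D \<longrightarrow> inj_on \<psi> (edges_at ((K - R) \<union> X) v)" by auto
    have "e \<in> R" using insert by auto
    have eL: "insert e ((K - R) \<union> X) \<subseteq> K" "e \<notin> (K - R) \<union> X" "e \<inter> D \<noteq> {}"
      using R(1,4) insert.hyps insert.prems by auto
    have inj: "inj_on \<psi> (edges_at ((K - R) \<union> X) v)" if "v \<notin> D" for v using \<psi>(3) that by blast
    obtain c where c: "c \<in> C"
      "\<forall>v. v \<notin> D \<longrightarrow> inj_on (\<psi>(e := c)) (edges_at (insert e ((K - R) \<union> X)) v)"
      using extend_coloring[OF K degnD eL \<psi>(1) inj C] by blast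
    show ?case
    proof (intro exI[of _ "\<psi>(e := c)"] conjI)
      show "\<forall>v. v \<notin> D \<longrightarrow> inj_on (\<psi>(e := c)) (edges_at (K - R \<union> insert e X) v)"
        using c(2) by simp
    qed (use c(1) \<psi>(1,2) \<open>e \<in> R\<close> in auto)
  qed
  from this[OF order_refl] obtain \<psi> where \<psi>: "\<psi> ` ((K - R) \<union> R) \<subseteq> C" "\<forall>e\<in>K - R. \<psi> e = \<psi>0 e"
       "\<forall>v. v \<notin> D \<longrightarrow> inj_on \<psi> (edges_at ((K - R) \<union> R) v)" by blast
  have KR: "(K - R) \<union> R = K" using R by auto
  have "proper_on (K - R) C \<psi>"
    unfolding proper_on_def
  proof (intro conjI allI)
    show "\<psi> ` (K - R) \<subseteq> C" using \<psi> by auto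
    fix v
    have "inj_on \<psi>0 (edges_at (K - R) v)" using \<psi>0 unfolding proper_on_def by blast
    then show "inj_on \<psi> (edges_at (K - R) v)"
      using \<psi>(2) by (auto simp: inj_on_def edges_at_def)
  qed
  then show ?thesis using R \<psi> RD unfolding KR D_def by blast
qed

text \<open>The bound 2 leaves room for one more edge at each ordinary vertex, from a matching put
  back or from a class brought into the palette. Existence rests on \<open>R\<close> having at most
  two edges against three colors.\<close>

lemma matching_reducing_degrees:
  assumes K: "K \<subseteq> E" and deg: "\<And>v. card (edges_at K v) \<le> 4" and D: "card (excess K) \<le> 2"
  shows "\<exists>N \<subseteq> K. (\<forall>v. card (edges_at N v) \<le> 1) \<and>
           (\<forall>v. card (edges_at (K - N) v) \<le> (if v \<in> excess K then 3 else 2))"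
proof -
  let ?C = "{1..3::nat}"
  obtain R \<psi> where R: "R \<subseteq> K" "finite R" "card R \<le> 2" "\<psi> ` K \<subseteq> ?C" "proper_on (K - R) ?C \<psi>"
    "\<forall>v. v \<notin> excess K \<longrightarrow> inj_on \<psi> (edges_at K v)"
    "\<forall>v. v \<in> excess K \<longrightarrow> card (edges_at (K - R) v) = 3"
    using coloring_proper_off_excess[OF K deg D, of ?C] by auto
  have finK: "finite K" using K finite_E finite_subset by blast
  have "card (\<psi> ` R) < card ?C" using R card_image_le[of R \<psi>] by auto
  then have "\<not> ?C \<subseteq> \<psi> ` R" using R(2) by (meson card_mono finite_imageI not_le)
  then obtain d where d: "d \<in> ?C" "d \<notin> \<psi> ` R" by blast
  \<comment> \<open>Colors repeated at a vertex occur on \<open>R\<close>, so class \<open>d\<close> is a matching meeting every vertex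
    of degree at least 3.\<close>
  define N where "N = {e \<in> K. \<psi> e = d}"
  have N_eq: "N = {e \<in> K - R. \<psi> e = d}" using d unfolding N_def by auto
  \<comment> \<open>Three edges at \<open>v\<close> on which \<open>\<psi>\<close> is injective
    exhaust the three colors. This is applied with \<open>J = K - R\<close> at excess vertices and
    \<open>J = K\<close> elsewhere.\<close>
  have present: "edges_at N v \<noteq> {}"
    if J: "J \<subseteq> K" "inj_on \<psi> (edges_at J v)" "card (edges_at J v) = 3" for v J
  proof -
    have "\<psi> ` edges_at J v \<subseteq> ?C" using R(4) J by (auto simp: edges_at_def)
    moreover have "card (\<psi> ` edges_at J v) = 3" using J by (simp add: card_image)
    ultimately have "\<psi> ` edges_at J v = ?C" by (intro card_subset_eq) auto
    then obtain e where "e \<in> edges_at J v" "\<psi> e = d" using d(1) by (metis imageE)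
    then show ?thesis using J(1) by (auto simp: edges_at_def N_def)
  qed
  have less: "card (edges_at (K - N) v) < card (edges_at K v)" if "edges_at N v \<noteq> {}" for v
    using that finK by (intro psubset_card_mono) (auto simp: edges_at_def N_def)
  have "card (edges_at (K - N) v) \<le> (if v \<in> excess K then 3 else 2)" for v
  proof (cases "v \<in> excess K")
    case True
    have "inj_on \<psi> (edges_at (K - R) v)" using R(5) unfolding proper_on_def by blast
    then show ?thesis using less[OF present[of "K - R" v]] True R(7) deg[of v] by force
  next
    case False
    have "card (edges_at (K - N) v) \<le> card (edges_at K v)"
      using card_edges_at_mono[OF finK, of "K - N" v] by auto
    moreover have "card (edges_at K v) \<le> 3" using False by (auto simp: excess_def)
    ultimately show ?thesis using less[OF present[of K v]] False R(6) by force
  qed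
  moreover have "card (edges_at N v) \<le> 1" for v
    unfolding N_eq using color_class_matching[OF R(5)] .
  moreover have "N \<subseteq> K" by (auto simp: N_def)
  ultimately show ?thesis by blast
qed

section \<open>Moving a matching towards a color class\<close>

definition colored :: "('a set \<Rightarrow> nat) \<Rightarrow> nat set \<Rightarrow> 'a set set" where
  "colored f S = {e \<in> E. f e \<in> S}"

text \<open>The set \<open>F\<close> is a candidate for class \<open>t\<close>, not necessarily a
  class of \<open>f\<close>. Two excess vertices are as many as
  \<open>matching_reducing_degrees\<close> tolerates.\<close>

definition near_state ::
  "nat set \<Rightarrow> nat \<Rightarrow> ('a set \<Rightarrow> nat) \<Rightarrow> nat set \<Rightarrow> 'a set set \<Rightarrow> bool" where
  "near_state T t f S F \<longleftrightarrow> proper_on E T f \<and> S \<subseteq> T \<and> card S = 4 \<and> t \<in> S \<and> F \<subseteq> colored f S \<and>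
     (\<forall>v. card (edges_at F v) \<le> 1) \<and> card (excess (colored f S - F)) \<le> 2"

lemma colored_subset: "colored f S \<subseteq> E"
  by (auto simp: colored_def)

lemma finite_colored: "finite (colored f S)"
  using colored_subset finite_E finite_subset by blast

lemma near_state_degree:
  assumes "near_state T t f S F"
  shows "card (edges_at (colored f S) v) \<le> 4"
  using assms proper_on_card_colors[of E T f S v] card_ge_0_finite[of S]
  unfolding near_state_def colored_def by simp

text \<open>Four colors allow at most four edges of \<open>colored f S\<close> at \<open>x\<close>,
  and four of them already lie outside \<open>F\<close>.\<close>

lemma near_state_uncovered:
  assumes st: "near_state T t f S F" and x: "x \<in> excess (colored f S - F)"
  shows "edges_at F x = {}"
proof -
  let ?H = "colored f S"
  have "4 \<le> card (edges_at (?H - F) x)" using x by (simp add: excess_def)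
  then have "edges_at (?H - F) x = edges_at ?H x"
    using near_state_degree[OF st, of x]
    by (intro card_seteq) (auto simp: finite_colored edges_at_def)
  then show ?thesis using st unfolding near_state_def edges_at_def by auto
qed

text \<open>Split a matching \<open>N\<close> off \<open>K = H - F\<close>, recolor \<open>H\<close>
  so that \<open>N\<close> becomes the class of some \<open>d\<close> other than \<open>t\<close>,
  and exchange \<open>d\<close> for \<open>c\<close> in the palette. Class \<open>c\<close> adds at
  most one edge per vertex, so ordinary vertices go from at most 2 to at most 3, and an excess
  vertex lacking \<open>c\<close> stays at 3 or less.\<close>

lemma switch_color:
  assumes st: "near_state T t f S F" and c: "c \<in> T" "c \<notin> S"
  shows "\<exists>f' S'. recolor_step E T f f' \<and> near_state T t f' S' F \<and> c \<in> S' \<and>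
           (\<forall>e\<in>E. f e = c \<longrightarrow> f' e = c) \<and>
           excess (colored f' S' - F) \<subseteq> excess (colored f S - F) \<and>
           (\<forall>x. c \<notin> f ` edges_at E x \<longrightarrow> x \<notin> excess (colored f' S' - F))"
proof -
  define H where "H = colored f S"
  define K where "K = H - F"
  have pf: "proper_on E T f" and ST: "S \<subseteq> T" and S4: "card S = 4" and tS: "t \<in> S" and FH: "F \<subseteq> H"
    and F1: "\<And>v. card (edges_at F v) \<le> 1" and D2: "card (excess K) \<le> 2"
    using st unfolding near_state_def H_def K_def by auto
  have finS: "finite S" using S4 by (simp add: card_ge_0_finite)
  have finH: "finite H" and HE: "H \<subseteq> E" unfolding H_def by (simp_all add: finite_colored colored_subset)
  have degH: "card (edges_at H v) \<le> 4" for v using near_state_degree[OF st] H_def by simp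
  have degK: "card (edges_at K v) \<le> 4" for v
    using degH[of v] card_edges_at_mono[OF finH, of K v] unfolding K_def by auto
  obtain N where N: "N \<subseteq> K" "\<And>v. card (edges_at N v) \<le> 1"
    "\<And>v. card (edges_at (K - N) v) \<le> (if v \<in> excess K then 3 else 2)"
    using matching_reducing_degrees[OF _ degK D2] HE unfolding K_def by blast
  have "card (S - {t}) \<noteq> 0" using S4 tS finS by simp
  then have "S - {t} \<noteq> {}" by force
  then obtain d where d: "d \<in> S" "d \<noteq> t" by blast
  \<comment> \<open>An excess vertex has no edge of \<open>F\<close>; elsewhere \<open>F\<close>
    adds at most one edge to at most two.\<close>
  have degHN: "card (edges_at (H - N) v) \<le> 3" for v
  proof (cases "v \<in> excess K")
    case True
    then have "edges_at F v = {}" using near_state_uncovered[OF st] unfolding K_def H_def by blast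
    then have "edges_at (H - N) v = edges_at (K - N) v" unfolding K_def by (auto simp: edges_at_simps)
    then show ?thesis using N(3)[of v] True by simp
  next
    case False
    have "edges_at (H - N) v \<subseteq> edges_at (K - N) v \<union> edges_at F v"
      unfolding K_def by (auto simp: edges_at_simps)
    then have "card (edges_at (H - N) v) \<le> card (edges_at (K - N) v \<union> edges_at F v)"
      using finH finite_subset[OF FH finH] by (intro card_mono) (auto simp: K_def)
    also have "\<dots> \<le> card (edges_at (K - N) v) + card (edges_at F v)" by (rule card_Un_le)
    also have "\<dots> \<le> 3" using N(3)[of v] False F1[of v] by simp
    finally show ?thesis .
  qed
  have "card (S - {d}) = 3" using S4 d finS by simp
  then obtain \<phi> where \<phi>: "proper_on (H - N) (S - {d}) \<phi>"
    using colorable[of "H - N" "S - {d}"] degHN HE by blast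
  define \<psi> where "\<psi> = (\<lambda>e. if e \<in> N then d else \<phi> e)"
  have NH: "N \<subseteq> H" using N(1) unfolding K_def by blast
  have "proper_on ((H - N) \<union> N) (insert d (S - {d})) \<psi>"
    unfolding \<psi>_def using NH finH by (intro proper_on_Un[OF \<phi> N(2)]) (auto intro: finite_subset)
  moreover have "(H - N) \<union> N = H" "insert d (S - {d}) = S" using NH d by auto
  ultimately have p\<psi>: "proper_on H S \<psi>" by simp
  define f' where "f' = (\<lambda>e. if e \<in> H then \<psi> e else f e)"
  have step: "recolor_step E T f f'"
    unfolding f'_def using recolor_step_override[OF pf ST _ p\<psi> finS] S4
    unfolding H_def colored_def by simp
  define S' where "S' = insert c (S - {d})"
  have \<phi>S: "\<phi> e \<in> S - {d}" if "e \<in> H - N" for e using \<phi> that unfolding proper_on_def by blast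
  \<comment> \<open>Exchanging \<open>d\<close> for \<open>c\<close> removes exactly
    \<open>N\<close> from the palette edges and adds the old class \<open>c\<close>. Since
    \<open>N\<close> avoids \<open>F\<close>, the matching stays inside.\<close>
  have H': "colored f' S' = (H - N) \<union> {e \<in> E. f e = c}"
  proof (intro set_eqI)
    fix e
    show "e \<in> colored f' S' \<longleftrightarrow> e \<in> (H - N) \<union> {e \<in> E. f e = c}"
    proof (cases "e \<in> H")
      case True
      then have "f e \<noteq> c" "e \<in> E" using c(2) unfolding H_def colored_def by auto
      then show ?thesis using True \<phi>S[of e] d c(2) unfolding colored_def f'_def S'_def \<psi>_def by auto
    next
      case False
      then show ?thesis unfolding colored_def f'_def S'_def H_def by auto
    qed
  qed
  have bound: "card (edges_at (colored f' S' - F) v)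
      \<le> card (edges_at (K - N) v) + card (edges_at {e \<in> E. f e = c} v)" for v
  proof -
    have "edges_at (colored f' S' - F) v \<subseteq> edges_at (K - N) v \<union> edges_at {e \<in> E. f e = c} v"
      unfolding H' K_def by (auto simp: edges_at_simps)
    then have "card (edges_at (colored f' S' - F) v)
        \<le> card (edges_at (K - N) v \<union> edges_at {e \<in> E. f e = c} v)"
      using finH finite_E by (intro card_mono) (auto simp: K_def)
    then show ?thesis using card_Un_le le_trans by blast
  qed
  have sub: "excess (colored f' S' - F) \<subseteq> excess K"
  proof
    fix v assume v: "v \<in> excess (colored f' S' - F)"
    show "v \<in> excess K"
    proof (rule ccontr)
      assume "v \<notin> excess K"
      then have "card (edges_at (colored f' S' - F) v) \<le> 3"
        using bound[of v] N(3)[of v] color_class_matching[OF pf, of c v] by simp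
      then show False using v by (simp add: excess_def)
    qed
  qed
  have miss: "x \<notin> excess (colored f' S' - F)" if "c \<notin> f ` edges_at E x" for x
  proof -
    have "edges_at {e \<in> E. f e = c} x = {}" using that by (auto simp: edges_at_def)
    then have "card (edges_at (colored f' S' - F) x) \<le> 3"
      using bound[of x] N(3)[of x] by (simp split: if_splits)
    then show ?thesis by (simp add: excess_def)
  qed
  have "near_state T t f' S' F"
    unfolding near_state_def
  proof (intro conjI allI F1)
    show "proper_on E T f'" using step unfolding recolor_step_def by blast
    show "S' \<subseteq> T" using ST c unfolding S'_def by auto
    show "card S' = 4" using S4 finS d c unfolding S'_def by simp
    show "t \<in> S'" using tS d unfolding S'_def by auto
    show "F \<subseteq> colored f' S'" using FH N(1) unfolding H' K_def by blast
    have "finite (excess K)" using finite_excess[of K] HE unfolding K_def by blast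
    then show "card (excess (colored f' S' - F)) \<le> 2"
      using sub D2 card_mono le_trans by blast
  qed
  moreover have "\<forall>e\<in>E. f e = c \<longrightarrow> f' e = c"
    using c(2) unfolding f'_def H_def colored_def by auto
  ultimately show ?thesis using step sub miss unfolding K_def H_def S'_def by blast
qed

text \<open>These vertices lose their edge of \<open>F\<close> when the edges of \<open>F\<close> at
  \<open>u\<close> are removed. Bounding by the degree instead of 1 gives 0 when \<open>u\<close> is
  uncovered.\<close>

lemma card_other_ends:
  assumes "F \<subseteq> E" "card (edges_at F u) \<le> 1"
  shows "finite (\<Union>(edges_at F u) - {u}) \<and> card (\<Union>(edges_at F u) - {u}) \<le> card (edges_at F u)"
proof (cases "edges_at F u = {}")
  case False
  have "finite (edges_at F u)" using finite_subset[OF assms(1) finite_E] by simp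
  then have "card (edges_at F u) = 1" using False assms(2) by (simp add: card_gt_0_iff le_antisym Suc_leI)
  then obtain e where e: "edges_at F u = {e}" by (auto simp: card_1_singleton_iff)
  then have "e \<in> E" "u \<in> e" using assms(1) by (auto simp: edges_at_def)
  then show ?thesis using card_edge[of e] e by (auto simp: card_2_iff card_insert_if)
qed auto

text \<open>Adding \<open>e\<close> displaces the edges of \<open>F\<close> that meet it, and only
  their far ends can become new excess vertices. Without earlier excess there are at most two.
  Otherwise the excess end of \<open>e\<close> is uncovered by \<open>F\<close>, so at most one edge
  is displaced, and that end leaves the excess.\<close>

lemma push_edge:
  assumes st: "near_state T t f S F" and e: "e \<in> colored f S"
    and D: "excess (colored f S - F) = {} \<or> excess (colored f S - F) \<inter> e \<noteq> {}"
  shows "near_state T t f S (insert e {e' \<in> F. e' \<inter> e = {}})"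
proof -
  define H where "H = colored f S"
  define D where "D = excess (H - F)"
  define F' where "F' = insert e {e' \<in> F. e' \<inter> e = {}}"
  have FH: "F \<subseteq> H" and F1: "\<And>v. card (edges_at F v) \<le> 1" and D2: "card D \<le> 2"
    using st unfolding near_state_def H_def D_def by auto
  have finH: "finite H" and HE: "H \<subseteq> E" unfolding H_def by (simp_all add: finite_colored colored_subset)
  have FE: "F \<subseteq> E" using FH HE by blast
  have finD: "finite D" unfolding D_def using finite_excess HE by blast
  have eH: "e \<in> H" using e H_def by simp
  have finF: "finite F" using FH finH finite_subset by blast
  \<comment> \<open>The ends are named so that \<open>u\<close> is an excess vertex whenever there
    is one.\<close>
  obtain u w where uw: "e = {u, w}" "D = {} \<or> u \<in> D"
  proof -
    obtain a b where ab: "e = {a, b}" using card_edge[of e] eH HE by (auto simp: card_2_iff)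
    consider "D = {} \<or> a \<in> D" | "b \<in> D" using D ab unfolding D_def H_def by blast
    then show ?thesis using that[of a b] that[of b a] ab by (cases; auto)
  qed
  define X where "X = \<Union>(edges_at F u) - {u}"
  define Y where "Y = \<Union>(edges_at F w) - {w}"
  have X: "finite X" "card X \<le> card (edges_at F u)" and Y: "finite Y" "card Y \<le> card (edges_at F w)"
    using card_other_ends[OF FE F1] unfolding X_def Y_def by auto
  have sub: "excess (H - F') \<subseteq> (D - {u}) \<union> X \<union> Y"
  proof
    fix v assume v: "v \<in> excess (H - F')"
    have vne: "v \<notin> e"
    proof
      assume "v \<in> e"
      then have "edges_at (H - F') v \<subset> edges_at H v"
        using eH unfolding F'_def by (auto simp: edges_at_def)
      then have "card (edges_at (H - F') v) < card (edges_at H v)"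
        using finH by (intro psubset_card_mono) auto
      then show False using near_state_degree[OF st, of v] v unfolding excess_def H_def by simp
    qed
    show "v \<in> (D - {u}) \<union> X \<union> Y"
    proof (rule ccontr)
      assume no: "v \<notin> (D - {u}) \<union> X \<union> Y"
      then have "edges_at F' v = edges_at F v"
        using vne uw(1) unfolding F'_def X_def Y_def by (auto simp: edges_at_def)
      then have "edges_at (H - F') v = edges_at (H - F) v" by (simp add: edges_at_simps)
      then have "v \<in> D" using v unfolding D_def excess_def by simp
      then show False using no vne uw by auto
    qed
  qed
  have "card ((D - {u}) \<union> X \<union> Y) \<le> card (D - {u}) + card X + card Y"
    using card_Un_le[of "D - {u} \<union> X" Y] card_Un_le[of "D - {u}" X] by linarith
  \<comment> \<open>The three terms are at most 0, 1, 1 without earlier excess and 1, 0, 1 with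
    it.\<close>
  also have "\<dots> \<le> 2"
  proof (cases "D = {}")
    case True
    then show ?thesis using X Y F1[of u] F1[of w] by simp
  next
    case False
    then have u: "u \<in> D" using uw by blast
    then have "edges_at F u = {}" using near_state_uncovered[OF st] unfolding D_def H_def by blast
    moreover have "card (D - {u}) \<le> 1" using u D2 finD by simp
    ultimately show ?thesis using X Y F1[of w] by simp
  qed
  finally have "card (excess (H - F')) \<le> 2"
    using sub finD X Y card_mono[of "(D - {u}) \<union> X \<union> Y" "excess (H - F')"] by simp
  moreover have "card (edges_at F' v) \<le> 1" for v
  proof (cases "v \<in> e")
    case True
    then have "edges_at F' v = {e}" unfolding F'_def by (auto simp: edges_at_def)
    then show ?thesis by simp
  next
    case False
    then have "edges_at F' v \<subseteq> edges_at F v" unfolding F'_def by (auto simp: edges_at_def)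
    then show ?thesis using F1[of v] finF card_mono[of "edges_at F v" "edges_at F' v"] by simp
  qed
  moreover have "F' \<subseteq> H" using eH FH unfolding F'_def by auto
  ultimately show ?thesis
    using st unfolding near_state_def H_def F'_def by auto
qed

text \<open>The weight 3 exceeds the largest possible excess 2, so gaining an edge of
  \<open>M\<close> pays for any excess vertices created.\<close>

lemma progress:
  assumes T: "finite T" and g: "proper_on E T g" and st: "near_state T t f S F"
    and M: "M = {e \<in> E. g e = t}"
    and not_done: "\<not> M \<subseteq> F \<or> excess (colored f S - F) \<noteq> {}"
  shows "\<exists>f' S' F'. (recolor_step E T)\<^sup>*\<^sup>* f f' \<and> near_state T t f' S' F' \<and>
    3 * card (M - F') + card (excess (colored f' S' - F')) < 3 * card (M - F) + card (excess (colored f S - F))"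
proof -
  define D where "D = excess (colored f S - F)"
  have finD: "finite D" unfolding D_def using finite_excess colored_subset by (meson Diff_subset order_trans)
  have finM: "finite M" using M finite_E by simp
  have M1: "card (edges_at M v) \<le> 1" for v unfolding M using color_class_matching[OF g] .
  have pf: "proper_on E T f" and FE: "F \<subseteq> E" and ST: "S \<subseteq> T" and S4: "card S = 4"
    and tT: "t \<in> T"
    using st colored_subset[of f S] unfolding near_state_def by auto
  have finS: "finite S" using S4 by (simp add: card_ge_0_finite)
  \<comment> \<open>If the color of \<open>e\<close> is outside the palette, it is switched in
    first. The switch may clear the excess on \<open>e\<close> while some remains elsewhere; then
    \<open>e\<close> is not pushed, but the excess has already shrunk.\<close>
  have push: ?thesis if e: "e \<in> M" "e \<notin> F" "D = {} \<or> D \<inter> e \<noteq> {}" for e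
  proof -
    have eE: "e \<in> E" using e M by simp
    have "\<exists>f' S'. (recolor_step E T)\<^sup>*\<^sup>* f f' \<and> near_state T t f' S' F \<and> f' e \<in> S' \<and>
             excess (colored f' S' - F) \<subseteq> D"
    proof (cases "f e \<in> S")
      case True
      then show ?thesis using st unfolding D_def by blast
    next
      case False
      moreover have "f e \<in> T" using pf eE unfolding proper_on_def by blast
      ultimately show ?thesis
        using switch_color[OF st, of "f e"] eE unfolding D_def by (metis r_into_rtranclp)
    qed
    then obtain f' S' where f': "(recolor_step E T)\<^sup>*\<^sup>* f f'" "near_state T t f' S' F" "f' e \<in> S'"
      "excess (colored f' S' - F) \<subseteq> D" by blast
    define D' where "D' = excess (colored f' S' - F)"
    show ?thesis
    proof (cases "D' = {} \<or> D' \<inter> e \<noteq> {}")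
      case True
      define F' where "F' = insert e {e' \<in> F. e' \<inter> e = {}}"
      have "near_state T t f' S' F'" unfolding F'_def
        using push_edge[OF f'(2), of e] True eE f'(3) unfolding D'_def colored_def by blast
      \<comment> \<open>No edge of \<open>M\<close> is displaced, because \<open>M\<close> is a
        matching containing \<open>e\<close>.\<close>
      moreover have "M - F' \<subseteq> M - F - {e}"
      proof
        fix m assume m: "m \<in> M - F'"
        have "m \<notin> F"
        proof
          assume "m \<in> F"
          then obtain v where "v \<in> m" "v \<in> e" using m unfolding F'_def by auto
          then have "m \<in> edges_at M v" "e \<in> edges_at M v" using m e by (auto simp: edges_at_def)
          then have "m = e"
            using M1[of v] card_le_Suc0_iff_eq[OF finite_edges_at[OF finM], of v] by simp
          then show False using m unfolding F'_def by simp
        qed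
        then show "m \<in> M - F - {e}" using m unfolding F'_def by auto
      qed
      then have "card (M - F') \<le> card (M - F - {e})" using finM by (intro card_mono) auto
      moreover have "card (M - F - {e}) < card (M - F)"
        using e finM by (intro psubset_card_mono) auto
      moreover have "card (excess (colored f' S' - F')) \<le> 2"
        using \<open>near_state T t f' S' F'\<close> unfolding near_state_def by blast
      ultimately show ?thesis using f'(1)
        by (intro exI[of _ f'] exI[of _ S'] exI[of _ F']) auto
    next
      case False
      then have "D' \<subset> D" using f'(4) e(3) unfolding D'_def by blast
      then have "card D' < card D" using finD by (rule psubset_card_mono[rotated])
      then show ?thesis using f'(1,2) unfolding D'_def D_def
        by (intro exI[of _ f'] exI[of _ S'] exI[of _ F]) auto
    qed
  qed
  show ?thesis
  proof (cases "D = {}")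
    case True
    then show ?thesis using not_done push unfolding D_def by blast
  next
    case False
    then obtain x where x: "x \<in> D" by blast
    have Fx: "edges_at F x = {}" using near_state_uncovered[OF st] x unfolding D_def by blast
    show ?thesis
    proof (cases "edges_at M x = {}")
      case False
      then obtain e where e: "e \<in> M" "x \<in> e" by (auto simp: edges_at_def)
      then have "e \<notin> F" using Fx by (auto simp: edges_at_def)
      then show ?thesis using push[of e] e x by blast
    next
      \<comment> \<open>Then \<open>x\<close> has fewer than \<open>card T\<close> edges, so \<open>f\<close> misses a color at \<open>x\<close>; bringing that color
        into \<open>S\<close> lowers the degree of \<open>x\<close>.\<close>
      case True
      have "g ` edges_at E x \<subseteq> T - {t}"
        using g True unfolding proper_on_def M edges_at_def by auto
      moreover have "inj_on g (edges_at E x)" using g unfolding proper_on_def by blast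
      ultimately have "card (edges_at E x) \<le> card (T - {t})" using T by (meson card_inj_on_le finite_Diff)
      also have "\<dots> < card T" using T tT by (meson card_Diff1_less)
      finally have "card (f ` edges_at E x) < card T"
        using card_image_le[of "edges_at E x" f] finite_E by simp
      then have "\<not> T \<subseteq> f ` edges_at E x"
        using finite_E by (meson card_mono finite_edges_at finite_imageI not_le)
      then obtain c where c: "c \<in> T" "c \<notin> f ` edges_at E x" by blast
      \<comment> \<open>Otherwise only three palette colors could occur at \<open>x\<close>, too few
        for excess.\<close>
      have "c \<notin> S"
      proof
        assume cS: "c \<in> S"
        have "edges_at (colored f S) x \<subseteq> edges_at {e \<in> E. f e \<in> S - {c}} x"
          using c(2) unfolding colored_def edges_at_def by auto
        then have "card (edges_at (colored f S) x) \<le> card (edges_at {e \<in> E. f e \<in> S - {c}} x)"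
          using finite_E by (intro card_mono) auto
        also have "\<dots> \<le> card (S - {c})" using proper_on_card_colors[OF pf] finS by blast
        also have "\<dots> = 3" using cS S4 finS by simp
        finally have "card (edges_at (colored f S - F) x) \<le> 3"
          using card_edges_at_mono[OF finite_colored, of "colored f S - F" f S x] by auto
        then show False using x unfolding D_def excess_def by simp
      qed
      then obtain f' S' where f': "recolor_step E T f f'" "near_state T t f' S' F"
        "excess (colored f' S' - F) \<subseteq> D" "x \<notin> excess (colored f' S' - F)"
        using switch_color[OF st c(1)] c(2) unfolding D_def by blast
      then have "excess (colored f' S' - F) \<subset> D" using x by blast
      then have "card (excess (colored f' S' - F)) < card D" using finD by (rule psubset_card_mono[rotated])
      then show ?thesis using f'(1,2) unfolding D_def
        by (intro exI[of _ f'] exI[of _ S'] exI[of _ F]) auto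
    qed
  qed
qed

text \<open>Iterating \<open>progress\<close> ends with \<open>M\<close> inside \<open>F\<close> and
  \<open>H - F\<close> subcubic; then \<open>H - F\<close> takes the colors \<open>S - {t}\<close>
  and \<open>F\<close> takes \<open>t\<close>. Only an inclusion results, since \<open>F\<close> may
  keep edges outside \<open>M\<close>.\<close>

lemma reach_near_state:
  assumes T: "finite T" and g: "proper_on E T g" and M: "M = {e \<in> E. g e = t}"
    and st: "near_state T t f S F"
  shows "\<exists>f'. (recolor_step E T)\<^sup>*\<^sup>* f f' \<and> M \<subseteq> {e \<in> E. f' e = t}"
  using st
proof (induction "3 * card (M - F) + card (excess (colored f S - F))" arbitrary: f S F rule: less_induct)
  case less
  show ?case
  proof (cases "\<not> M \<subseteq> F \<or> excess (colored f S - F) \<noteq> {}")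
    case True
    then obtain f' S' F' where f': "(recolor_step E T)\<^sup>*\<^sup>* f f'" "near_state T t f' S' F'"
      "3 * card (M - F') + card (excess (colored f' S' - F')) < 3 * card (M - F) + card (excess (colored f S - F))"
      using progress[OF T g less.prems M] by blast
    then show ?thesis using less.hyps[OF f'(3,2)] by (meson rtranclp_trans)
  next
    case False
    define H where "H = colored f S"
    have MF: "M \<subseteq> F" and ex: "excess (H - F) = {}" using False H_def by auto
    have pf: "proper_on E T f" and FH: "F \<subseteq> H" and ST: "S \<subseteq> T" and S4: "card S = 4"
      and tS: "t \<in> S" and F1: "\<And>v. card (edges_at F v) \<le> 1"
      using less.prems unfolding near_state_def H_def by auto
    have finS: "finite S" using S4 by (simp add: card_ge_0_finite)
    have "card (S - {t}) = 3" using S4 tS finS by simp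
    moreover have "card (edges_at (H - F) v) \<le> 3" for v
    proof -
      have "v \<notin> excess (H - F)" using ex by simp
      then show ?thesis by (simp add: excess_def)
    qed
    moreover have HE: "H \<subseteq> E" unfolding H_def by (rule colored_subset)
    ultimately obtain \<phi> where \<phi>: "proper_on (H - F) (S - {t}) \<phi>"
      using colorable[of "H - F" "S - {t}"] by blast
    define \<psi> where "\<psi> = (\<lambda>e. if e \<in> F then t else \<phi> e)"
    have "proper_on ((H - F) \<union> F) (insert t (S - {t})) \<psi>"
      unfolding \<psi>_def using FH finite_colored[of f S]
      by (intro proper_on_Un[OF \<phi> F1]) (auto intro: finite_subset simp: H_def)
    moreover have "(H - F) \<union> F = H" "insert t (S - {t}) = S" using FH tS by auto
    ultimately have p\<psi>: "proper_on H S \<psi>" by simp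
    have "recolor_step E T f (\<lambda>e. if e \<in> H then \<psi> e else f e)"
      using recolor_step_override[OF pf ST _ p\<psi> finS] S4 unfolding H_def colored_def by simp
    moreover have "M \<subseteq> {e \<in> E. (if e \<in> H then \<psi> e else f e) = t}"
      using MF FH HE unfolding \<psi>_def by auto
    ultimately show ?thesis by blast
  qed
qed

text \<open>The walk starts from class \<open>t\<close> of \<open>f\<close> and any three further
  colors: three colors alone create no excess.\<close>

lemma reach_superset_class:
  assumes T: "finite T" "card T \<ge> 4" "t \<in> T" and f: "proper_on E T f" and g: "proper_on E T g"
  shows "\<exists>f'. (recolor_step E T)\<^sup>*\<^sup>* f f' \<and> {e \<in> E. g e = t} \<subseteq> {e \<in> E. f' e = t}"
proof -
  have "3 \<le> card (T - {t})" using T by simp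
  then obtain S0 where S0: "S0 \<subseteq> T - {t}" "card S0 = 3" by (meson obtain_subset_with_card_n)
  have finS0: "finite S0" using S0 by (simp add: card_ge_0_finite)
  define F where "F = {e \<in> E. f e = t}"
  have "card (edges_at (colored f (insert t S0) - F) v) \<le> 3" for v
  proof -
    have "colored f (insert t S0) - F = {e \<in> E. f e \<in> S0}"
      using S0(1) unfolding colored_def F_def by auto
    then show ?thesis using proper_on_card_colors[OF f finS0, of v] S0(2) by simp
  qed
  then have "excess (colored f (insert t S0) - F) = {}"
    unfolding excess_def by (simp add: not_le less_Suc_eq_le numeral_eq_Suc)
  moreover have "card (insert t S0) = 4" using S0 finS0 by (subst card_insert_disjoint) auto
  ultimately have "near_state T t f (insert t S0) F"
    unfolding near_state_def using f S0 T color_class_matching[OF f]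
    by (auto simp: F_def colored_def)
  then show ?thesis using reach_near_state[OF T(1) g refl] by blast
qed

end

section \<open>Connectivity by four-class recolorings\<close>

lemma subcubic_colorable_subset:
  assumes "subcubic_colorable E" "E' \<subseteq> E"
  shows "subcubic_colorable E'"
  using assms unfolding subcubic_colorable_def by (meson finite_subset subset_iff subset_trans)

text \<open>All edges of color \<open>t\<close> stay inside the matching \<open>F\<close>
  throughout, so its edges can be recolored one at a time, each step touching two classes.\<close>

lemma recolor_steps_enlarge_class:
  assumes E: "finite E" and g: "proper_on E T g" and t: "t \<in> T"
    and F: "F \<subseteq> E" "\<And>v. card (edges_at F v) \<le> 1" "{e \<in> E. g e = t} \<subseteq> F"
  shows "(recolor_step E T)\<^sup>*\<^sup>* g (\<lambda>e. if e \<in> F then t else g e)"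
proof -
  have finF: "finite F" using F E finite_subset by blast
  have proper: "proper_on E T (\<lambda>e. if e \<in> X then t else g e)" if X: "X \<subseteq> F" for X
    unfolding proper_on_def
  proof (intro conjI allI inj_onI)
    show "(\<lambda>e. if e \<in> X then t else g e) ` E \<subseteq> T" using g t unfolding proper_on_def by auto
    fix v x y
    assume xy: "x \<in> edges_at E v" "y \<in> edges_at E v"
      and eq: "(if x \<in> X then t else g x) = (if y \<in> X then t else g y)"
    consider "x \<in> F" "y \<in> F" | "x \<notin> X" "y \<notin> X"
      using eq xy X F(3) by (auto simp: edges_at_def split: if_splits)
    then show "x = y"
    proof cases
      case 1
      then have "x \<in> edges_at F v" "y \<in> edges_at F v" using xy by (auto simp: edges_at_def)
      then show ?thesis
        using F(2)[of v] card_le_Suc0_iff_eq[OF finite_edges_at[OF finF], of v] by simp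
    next
      case 2
      then show ?thesis using eq xy g unfolding proper_on_def inj_on_def by auto
    qed
  qed
  have "(recolor_step E T)\<^sup>*\<^sup>* g (\<lambda>e. if e \<in> X then t else g e)" if "X \<subseteq> F" for X
    using finite_subset[OF that finF] that
  proof (induction X rule: finite_induct)
    case empty
    then show ?case by simp
  next
    case (insert x X)
    have "recolor_step E T (\<lambda>e. if e \<in> X then t else g e) (\<lambda>e. if e \<in> insert x X then t else g e)"
      unfolding recolor_step_def
    proof (intro conjI proper)
      show "\<exists>S. finite S \<and> card S \<le> 4 \<and> (\<forall>e\<in>E.
          (if e \<in> X then t else g e) = (if e \<in> insert x X then t else g e) \<or>
          (if e \<in> X then t else g e) \<in> S \<and> (if e \<in> insert x X then t else g e) \<in> S)"
        by (intro exI[of _ "{g x, t}"]) (auto simp: card_insert_if)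
    qed (use insert in auto)
    then show ?case using insert by (auto intro: rtranclp.rtrancl_into_rtrancl)
  qed
  then show ?thesis by simp
qed

text \<open>Steps on \<open>E - F\<close> use only colors of \<open>T\<close>, so the constant class
  \<open>F\<close> never interferes.\<close>

lemma recolor_steps_extend:
  assumes t: "t \<notin> T" and F: "F \<subseteq> E" "finite F" "\<And>v. card (edges_at F v) \<le> 1"
    and steps: "(recolor_step (E - F) T)\<^sup>*\<^sup>* f g"
  shows "(recolor_step E (insert t T))\<^sup>*\<^sup>* (\<lambda>e. if e \<in> F then t else f e) (\<lambda>e. if e \<in> F then t else g e)"
  using steps
proof (induction rule: rtranclp_induct)
  case (step p q)
  have EF: "E - F \<union> F = E" using F by auto
  have "recolor_step E (insert t T) (\<lambda>e. if e \<in> F then t else p e) (\<lambda>e. if e \<in> F then t else q e)"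
    unfolding recolor_step_def
  proof (intro conjI)
    show "proper_on E (insert t T) (\<lambda>e. if e \<in> F then t else p e)"
      "proper_on E (insert t T) (\<lambda>e. if e \<in> F then t else q e)"
      using step(2) proper_on_Un[OF _ F(3) F(2) t, of "E - F"] unfolding recolor_step_def EF by blast+
    obtain S where "finite S" "card S \<le> 4" "\<forall>e\<in>E - F. p e = q e \<or> p e \<in> S \<and> q e \<in> S"
      using step(2) unfolding recolor_step_def by blast
    then show "\<exists>S. finite S \<and> card S \<le> 4 \<and> (\<forall>e\<in>E.
        (if e \<in> F then t else p e) = (if e \<in> F then t else q e) \<or>
        (if e \<in> F then t else p e) \<in> S \<and> (if e \<in> F then t else q e) \<in> S)"
      by (intro exI[of _ S]) auto
  qed
  then show ?case using step by (auto intro: rtranclp.rtrancl_into_rtrancl)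
qed simp

lemma recolor_step_sym: "recolor_step E T f g \<Longrightarrow> recolor_step E T g f"
proof -
  assume fg: "recolor_step E T f g"
  then obtain S where "finite S" "card S \<le> 4" "\<forall>e\<in>E. f e = g e \<or> f e \<in> S \<and> g e \<in> S"
    unfolding recolor_step_def by blast
  then have "\<exists>S. finite S \<and> card S \<le> 4 \<and> (\<forall>e\<in>E. g e = f e \<or> g e \<in> S \<and> f e \<in> S)"
    by (intro exI[of _ S]) auto
  then show ?thesis using fg unfolding recolor_step_def by blast
qed

text \<open>The color set is not tied to the chromatic index, because the induction drops a color
  together with a matching.\<close>

theorem recolor_steps_connected:
  assumes "finite T" "subcubic_colorable E" "proper_on E T f" "proper_on E T g"
  shows "(recolor_step E T)\<^sup>*\<^sup>* f g"
  using assms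
proof (induction T arbitrary: E f g rule: finite_induct)
  case empty
  then have "recolor_step E {} f g" unfolding recolor_step_def proper_on_def by auto
  then show ?case by blast
next
  case (insert t T)
  interpret subcubic_colorable E by fact
  have T: "finite (insert t T)" using insert by simp
  have sym: "(recolor_step E (insert t T))\<^sup>*\<^sup>* b a" if "(recolor_step E (insert t T))\<^sup>*\<^sup>* a b" for a b
    using that
    by (induction rule: rtranclp_induct) (auto intro: recolor_step_sym converse_rtranclp_into_rtranclp)
  show ?case
  proof (cases "card (insert t T) \<le> 4")
    case True
    \<comment> \<open>The whole color set serves as \<open>S\<close>.\<close>
    then have "recolor_step E (insert t T) f g"
      using insert.prems T unfolding recolor_step_def proper_on_def
      by (intro conjI exI[of _ "insert t T"]) blast+
    then show ?thesis by blast
  next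
    case False
    then obtain f' where f': "(recolor_step E (insert t T))\<^sup>*\<^sup>* f f'"
      "{e \<in> E. g e = t} \<subseteq> {e \<in> E. f' e = t}"
      using reach_superset_class[OF T, of t f g] insert.prems by auto
    have pf': "proper_on E (insert t T) f'"
      using f'(1) insert.prems(2) by (induction rule: rtranclp_induct) (auto simp: recolor_step_def)
    define F where "F = {e \<in> E. f' e = t}"
    have F: "F \<subseteq> E" "finite F" "\<And>v. card (edges_at F v) \<le> 1"
      using color_class_matching[OF pf'] finite_E unfolding F_def by auto
    have proper_diff: "proper_on (E - F) T h"
      if "proper_on E (insert t T) h" "{e \<in> E. h e = t} \<subseteq> F" for h
    proof (rule proper_on_subset[OF that(1)])
      show "h ` (E - F) \<subseteq> T" using that unfolding proper_on_def by blast
    qed auto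
    have "proper_on (E - F) T f'" "proper_on (E - F) T g"
      using proper_diff pf' insert.prems(3) f'(2) unfolding F_def by auto
    then have "(recolor_step (E - F) T)\<^sup>*\<^sup>* f' g"
      by (intro insert.IH subcubic_colorable_subset[OF insert.prems(1)]) auto
    then have "(recolor_step E (insert t T))\<^sup>*\<^sup>*
        (\<lambda>e. if e \<in> F then t else f' e) (\<lambda>e. if e \<in> F then t else g e)"
      by (intro recolor_steps_extend insert.hyps(2) F)
    moreover have "(\<lambda>e. if e \<in> F then t else f' e) = f'" unfolding F_def by auto
    ultimately have f'g: "(recolor_step E (insert t T))\<^sup>*\<^sup>* f' (\<lambda>e. if e \<in> F then t else g e)"
      by simp
    \<comment> \<open>This walk leads from \<open>g\<close> to the coloring reached from
      \<open>f'\<close>; it is traversed backwards at the end.\<close>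
    have "(recolor_step E (insert t T))\<^sup>*\<^sup>* g (\<lambda>e. if e \<in> F then t else g e)"
      using recolor_steps_enlarge_class[OF finite_E insert.prems(3) _ F(1,3)] f'(2)
      unfolding F_def by blast
    then show ?thesis by (rule rtranclp_trans[OF rtranclp_trans[OF f'(1) f'g] sym])
  qed
qed

section \<open>From recoloring steps to n-equivalence\<close>

lemma proper_coloring_iff:
  "proper_coloring G t f \<longleftrightarrow> f \<in> extensional (edges G) \<and> proper_on (edges G) {1..t} f"
  unfolding proper_coloring_def proper_on_def PiE_def adjacent_edges_def inj_on_def edges_at_def
  by blast

lemma proper_coloring_restrict:
  "proper_on (edges G) {1..t} f \<Longrightarrow> proper_coloring G t (restrict f (edges G))"
  by (auto simp: proper_coloring_iff proper_on_def inj_on_def edges_at_def)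

text \<open>Restriction is needed because steps ignore values off the edge set, while proper
  colorings are extensional.\<close>

lemma recolor_steps_n_equivalent:
  assumes "(recolor_step (edges G) {1..t})\<^sup>*\<^sup>* f g" "proper_on (edges G) {1..t} f"
  shows "n_equivalent G t 4 (restrict f (edges G)) (restrict g (edges G))"
  using assms
proof (induction rule: rtranclp_induct)
  case base
  have "proper_coloring G t (restrict f (edges G))"
    using base by (rule proper_coloring_restrict)
  \<comment> \<open>A sequence needs at least one transition, so the empty walk becomes a constant
    sequence with \<open>k = 1\<close>.\<close>
  then show ?case unfolding n_equivalent_def
    by (intro exI[of _ 1] exI[of _ "\<lambda>_. restrict f (edges G)"]) (auto simp: differ_by_at_most_def)
next
  case (step p q)
  let ?r = "\<lambda>f. restrict f (edges G)"
  obtain k h where h: "k \<ge> 1" "h 0 = ?r f" "h k = ?r p" "\<forall>i\<le>k. proper_coloring G t (h i)"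
    "\<forall>i<k. differ_by_at_most G t 4 (h i) (h (Suc i))"
    using step unfolding n_equivalent_def by blast
  have pq: "proper_coloring G t (?r q)"
    using step(2) unfolding recolor_step_def by (blast intro: proper_coloring_restrict)
  obtain S where S: "finite S" "card S \<le> 4" "\<forall>e\<in>edges G. p e = q e \<or> p e \<in> S \<and> q e \<in> S"
    using step(2) unfolding recolor_step_def by blast
  have "{j \<in> {1..t}. color_class G (?r p) j \<noteq> color_class G (?r q) j} \<subseteq> S"
    using S(3) unfolding color_class_def by auto
  then have d: "differ_by_at_most G t 4 (?r p) (?r q)"
    unfolding differ_by_at_most_def using card_mono[OF S(1)] S(2) by (meson le_trans)
  define h' where "h' = (\<lambda>i. if i \<le> k then h i else ?r q)"
  show ?case unfolding n_equivalent_def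
  proof (intro exI[of _ "Suc k"] exI[of _ h'] conjI allI impI)
    fix i assume "i < Suc k"
    then show "differ_by_at_most G t 4 (h' i) (h' (Suc i))"
      using h d by (cases "i = k") (auto simp: h'_def)
  qed (use h pq in \<open>auto simp: h'_def\<close>)
qed

section \<open>Line perfect graphs\<close>

text \<open>A common vertex makes \<open>K\<close> a star, bounded by the degree. Otherwise edges
  avoiding \<open>u\<close> and \<open>v\<close> complete \<open>e\<close> to a triangle, and an
  edge meeting all three sides contains two of its corners.\<close>

lemma pairwise_intersecting_card:
  assumes fin: "finite K" and K: "\<And>e. e \<in> K \<Longrightarrow> card e = 2"
    and int: "\<And>e e'. e \<in> K \<Longrightarrow> e' \<in> K \<Longrightarrow> e \<inter> e' \<noteq> {}"
    and deg: "\<And>v. card (edges_at K v) \<le> 3"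
  shows "card K \<le> 3"
proof (cases "\<exists>v. \<forall>e\<in>K. v \<in> e")
  case True
  then obtain v where "edges_at K v = K" by (auto simp: edges_at_def)
  then show ?thesis using deg[of v] by simp
next
  case no: False
  then obtain e where e: "e \<in> K" by blast
  obtain u v where uv: "e = {u, v}" "u \<noteq> v" using K[OF e] by (auto simp: card_2_iff)
  have other: "\<exists>w. e' = {b, w}" if "e' \<in> K" "b \<in> e'" for e' b
    using K[OF that(1)] that(2) by (auto simp: card_2_iff)
  obtain e1 where e1: "e1 \<in> K" "u \<notin> e1" using no by blast
  then have "v \<in> e1" using int[OF e e1(1)] uv by auto
  then obtain w where w: "e1 = {v, w}" using other e1 by blast
  have w': "w \<noteq> u" "w \<noteq> v" using e1 w K[OF e1(1)] by auto
  obtain e2 where e2: "e2 \<in> K" "v \<notin> e2" using no by blast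
  then have "u \<in> e2" "w \<in> e2" using int[OF e e2(1)] int[OF e1(1) e2(1)] uv w by auto
  then have e2': "e2 = {u, w}" using other[OF e2(1), of u] w' by auto
  have "K \<subseteq> {{u, v}, {v, w}, {u, w}}"
  proof
    fix x assume x: "x \<in> K"
    obtain a b where ab: "x = {a, b}" using K[OF x] by (auto simp: card_2_iff)
    have "x \<inter> {u, v} \<noteq> {}" "x \<inter> {v, w} \<noteq> {}" "x \<inter> {u, w} \<noteq> {}"
      using int[OF x e] int[OF x e1(1)] int[OF x e2(1)] uv w e2' by auto
    then consider "u \<in> x" "v \<in> x" | "v \<in> x" "w \<in> x" | "u \<in> x" "w \<in> x" by blast
    then show "x \<in> {{u, v}, {v, w}, {u, w}}"
      using uv(2) w' unfolding ab by cases auto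
  qed
  then have "card K \<le> card {{u, v}, {v, w}, {u, w}}" by (intro card_mono) auto
  also have "\<dots> \<le> 3" by (simp add: card_insert_if)
  finally show ?thesis .
qed

text \<open>A clique of the line graph inside \<open>K\<close> consists of pairwise intersecting
  edges, so it has at most 3 members; perfection at \<open>K\<close> turns this into a
  3-coloring.\<close>

lemma line_perfect_subcubic_colorable:
  assumes G: "simple_graph G" and lp: "line_perfect G"
  shows "subcubic_colorable (edges G)"
proof
  have "edges G \<subseteq> Pow (verts G)" using G unfolding simple_graph_def by auto
  then show fin: "finite (edges G)" using G unfolding simple_graph_def by (meson finite_Pow_iff finite_subset)
  show c2: "card e = 2" if "e \<in> edges G" for e using G that unfolding simple_graph_def by blast
  fix K assume K: "K \<subseteq> edges G" and deg: "\<And>v. card (edges_at K v) \<le> 3"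
  define L where "L = induced_subgraph (line_graph G) K"
  have finK: "finite K" using K fin finite_subset by blast
  have vL: "verts L = K" unfolding L_def induced_subgraph_def by simp
  have eL: "{e, e'} \<in> edges L \<longleftrightarrow> e \<in> K \<and> e' \<in> K \<and> adjacent_edges e e'" for e e'
    using K unfolding L_def induced_subgraph_def line_graph_def adjacent_edges_def
    by (auto simp: doubleton_eq_iff)
  have "chromatic_number L = clique_number L"
    using lp K unfolding line_perfect_def perfect_graph_def L_def line_graph_def by simp
  also have "\<dots> \<le> 3"
    unfolding clique_number_def
  proof (rule Max.boundedI)
    have "{card Q |Q. clique L Q} \<subseteq> card ` Pow K" unfolding clique_def vL by auto
    then show "finite {card Q |Q. clique L Q}" using finK by (meson finite_Pow_iff finite_imageI finite_subset)
    have "clique L {}" unfolding clique_def by simp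
    then show "{card Q |Q. clique L Q} \<noteq> {}" by blast
    fix n assume "n \<in> {card Q |Q. clique L Q}"
    then obtain Q where Q: "n = card Q" "clique L Q" by blast
    have QK: "Q \<subseteq> K" using Q vL unfolding clique_def by simp
    have Q2: "card e = 2" if "e \<in> Q" for e using that QK K c2 by blast
    have "card Q \<le> 3"
    proof (rule pairwise_intersecting_card)
      show "finite Q" using QK finK finite_subset by blast
      show "card (edges_at Q v) \<le> 3" for v
        using card_edges_at_mono[OF finK QK] deg le_trans by blast
      show "e \<inter> e' \<noteq> {}" if "e \<in> Q" "e' \<in> Q" for e e'
      proof (cases "e = e'")
        case True
        then show ?thesis using Q2[OF that(1)] by auto
      next
        case False
        then show ?thesis using that Q(2) eL unfolding clique_def adjacent_edges_def by blast
      qed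
    qed (rule Q2)
    then show "n \<le> 3" using Q by simp
  qed
  finally have le: "chromatic_number L \<le> 3" .
  \<comment> \<open>Giving all edges distinct colors shows that some coloring exists, so the
    \<open>LEAST\<close> in \<open>chromatic_number\<close> is attained.\<close>
  obtain b :: "'a set \<Rightarrow> nat" where b: "bij_betw b K {1..card K}"
    using finite_same_card_bij[OF finK, of "{1..card K}"] by auto
  have "proper_vertex_coloring L (card K) (restrict b K)"
    using b unfolding proper_vertex_coloring_def vL eL adjacent_edges_def bij_betw_def inj_on_def by auto
  then obtain c where c: "proper_vertex_coloring L (chromatic_number L) c"
    unfolding chromatic_number_def
    using LeastI_ex[of "\<lambda>k. \<exists>c. proper_vertex_coloring L k c"] by blast
  have "proper_on K {1..3} c"
    unfolding proper_on_def
  proof (intro conjI allI inj_onI)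
    have "c ` K \<subseteq> {1..chromatic_number L}" using c unfolding proper_vertex_coloring_def vL by auto
    then show "c ` K \<subseteq> {1..3}" using le by fastforce
    fix v x y assume "x \<in> edges_at K v" "y \<in> edges_at K v" "c x = c y"
    then show "x = y"
      using c unfolding proper_vertex_coloring_def eL adjacent_edges_def edges_at_def by blast
  qed
  then show "\<exists>f. proper_on K {1..3} f" by blast
qed

theorem corollary4p3:
  fixes G :: "'a graph"
  assumes "simple_graph G"
    and "line_perfect G"
  shows "chi_trans G \<le> 4"
  unfolding chi_trans_def
proof (intro Least_le conjI allI impI)
  fix f g
  let ?t = "chromatic_index G"
  assume f: "proper_coloring G ?t f" and g: "proper_coloring G ?t g"
  have "(recolor_step (edges G) {1..?t})\<^sup>*\<^sup>* f g"
    using recolor_steps_connected[OF _ line_perfect_subcubic_colorable[OF assms]] f g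
    unfolding proper_coloring_iff by blast
  then have "n_equivalent G ?t 4 (restrict f (edges G)) (restrict g (edges G))"
    using recolor_steps_n_equivalent f unfolding proper_coloring_iff by blast
  then show "n_equivalent G ?t 4 f g"
    using f g unfolding proper_coloring_iff by (simp add: extensional_restrict)
qed simp

end
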